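(* Let $(G,\upsilon,\varepsilon)$ be a weighted multigraph and let $e$ be a nonloop edge of $G$. Then $$P_{(G,\upsilon,\varepsilon)}(t)=P_{(G-e,\upsilon,\varepsilon)}(t)-\varepsilon(e)\,P_{(G/e,\upsilon/e,\varepsilon)}(t).$$
   Context: A graph is a finite multigraph with vertex set $V$ and edge set $E$ (loops and multiple edges allowed). A weighted multigraph $(G,\upsilon,\varepsilon)$ is a graph $G$ with vertex weights $\upsilon:V\to\mathbb R_{>0}$ and edge weights $\varepsilon:E\to\mathbb R_{>0}$. For $u,v\in V$, $\varepsilon(u,v)$ is the total edge weight between $u$ and $v$, with loops counted twice, and $d_{(G,\varepsilon)}(u)=\sum_{v\in V}\varepsilon(u,v)$. The combinatorial Laplacian is the $V\times V$ matrix $L_{(G,\varepsilon)}=D_{(G,\varepsilon)}-A_{(G,\varepsilon)}$, where $A_{(G,\varepsilon)}=(\varepsilon(u,v))_{u,v}$ and $D_{(G,\varepsilon)}$ is diagonal with entries $d_{(G,\varepsilon)}(v)$. Let $W_\upsilon$ be the diagonal matrix with entries $\upsilon(v)$, and define $$P_{(G,\upsilon,\varepsilon)}(t)=\det(tW_\upsilon-L_{(G,\varepsilon)}).$$ $G-e$ is $G$ with the edge $e$ removed. $G/e$ is the graph obtained from $G$ by removing $e$ and identifying its two endpoints as a single vertex (other edges parallel to $e$ become loops). The weight function $\upsilon/e$ gives the new vertex the sum of the $\upsilon$-weights of the two endpoints of $e$, and gives every other vertex its weight under $\upsilon$. Edge weights of the remaining edges are inherited from $\varepsilon$. *)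

theory Defs
  imports
    "HOL-Analysis.Determinants"
    "HOL-Computational_Algebra.Polynomial"
    "HOL-Library.Uprod"
begin

text \<open>A loop at \<open>v\<close> is an edge whose unordered pair of ends is \<open>Upair v v\<close>;
  parallel edges are distinct members of \<open>edges\<close> with the same pair of ends.\<close>

record ('v, 'e) multigraph =
  verts :: "'v set"
  edges :: "'e set"
  ends :: "'e \<Rightarrow> 'v uprod"

locale weighted_multigraph =
  fixes G :: "('v, 'e) multigraph"
    and \<upsilon> :: "'v \<Rightarrow> real"
    and \<epsilon> :: "'e \<Rightarrow> real"
  assumes finite_verts: "finite (verts G)"
    and finite_edges: "finite (edges G)"
    and ends_in_verts: "\<And>a. a \<in> edges G \<Longrightarrow> set_uprod (ends G a) \<subseteq> verts G"
    and vertex_weight_pos: "\<And>v. v \<in> verts G \<Longrightarrow> \<upsilon> v > 0"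
    and edge_weight_pos: "\<And>a. a \<in> edges G \<Longrightarrow> \<epsilon> a > 0"

definition nonloop :: "('v, 'e) multigraph \<Rightarrow> 'e \<Rightarrow> bool" where
  "nonloop G a \<longleftrightarrow> proper_uprod (ends G a)"

definition total_weight :: "('v, 'e) multigraph \<Rightarrow> ('e \<Rightarrow> real) \<Rightarrow> 'v \<Rightarrow> 'v \<Rightarrow> real" where
  "total_weight G \<epsilon> u v =
     (if u = v then 2 else 1) * (\<Sum>a \<in> {a \<in> edges G. ends G a = Upair u v}. \<epsilon> a)"

definition weighted_degree :: "('v, 'e) multigraph \<Rightarrow> ('e \<Rightarrow> real) \<Rightarrow> 'v \<Rightarrow> real" where
  "weighted_degree G \<epsilon> u = (\<Sum>v \<in> verts G. total_weight G \<epsilon> u v)"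

text \<open>A matrix with rows and columns indexed by a finite set \<open>V\<close> is a binary function, of which
  only the values on \<open>V \<times> V\<close> matter. The vertex set changes under contraction, so the
  index set cannot be a fixed type.\<close>

definition diagonal :: "('v \<Rightarrow> 'a::zero) \<Rightarrow> 'v \<Rightarrow> 'v \<Rightarrow> 'a" where
  "diagonal d u v = (if u = v then d u else 0)"

definition laplacian :: "('v, 'e) multigraph \<Rightarrow> ('e \<Rightarrow> real) \<Rightarrow> 'v \<Rightarrow> 'v \<Rightarrow> real" where
  "laplacian G \<epsilon> u v = diagonal (weighted_degree G \<epsilon>) u v - total_weight G \<epsilon> u v"

definition det_on :: "'v set \<Rightarrow> ('v \<Rightarrow> 'v \<Rightarrow> 'a::comm_ring_1) \<Rightarrow> 'a" where
  "det_on V M = (\<Sum>p \<in> {p. p permutes V}. of_int (sign p) * (\<Prod>i \<in> V. M i (p i)))"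

lemma det_on_UNIV: "det_on UNIV (\<lambda>i j. A $ i $ j) = det A"
  by (simp add: det_on_def det_def)

text \<open>The determinant is taken over the polynomial ring \<open>\<real>[t]\<close>; the indeterminate \<open>t\<close> is
  \<open>[:0, 1:]\<close>, and the constant polynomial \<open>[:r:]\<close> embeds the real number \<open>r\<close>.\<close>

definition laplacian_poly ::
    "('v, 'e) multigraph \<Rightarrow> ('v \<Rightarrow> real) \<Rightarrow> ('e \<Rightarrow> real) \<Rightarrow> real poly" where
  "laplacian_poly G \<upsilon> \<epsilon> =
     det_on (verts G) (\<lambda>u v. [:0, 1:] * [:diagonal \<upsilon> u v:] - [:laplacian G \<epsilon> u v:])"

definition delete_edge :: "('v, 'e) multigraph \<Rightarrow> 'e \<Rightarrow> ('v, 'e) multigraph" where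
  "delete_edge G e = \<lparr>verts = verts G, edges = edges G - {e}, ends = ends G\<rparr>"

text \<open>The vertices of \<open>G/e\<close> are the classes of the partition of the vertices of \<open>G\<close> that
  identifies the two ends of \<open>e\<close>: the new vertex is the set of ends of \<open>e\<close>, and any other
  vertex \<open>w\<close> of \<open>G\<close> is represented by \<open>{w}\<close>.\<close>

definition identify_ends :: "('v, 'e) multigraph \<Rightarrow> 'e \<Rightarrow> 'v \<Rightarrow> 'v set" where
  "identify_ends G e w = (if w \<in> set_uprod (ends G e) then set_uprod (ends G e) else {w})"

definition contract_edge :: "('v, 'e) multigraph \<Rightarrow> 'e \<Rightarrow> ('v set, 'e) multigraph" where
  "contract_edge G e =
     \<lparr>verts = identify_ends G e ` verts G,
      edges = edges G - {e},
      ends = (\<lambda>a. map_uprod (identify_ends G e) (ends G a))\<rparr>"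

definition contract_weight ::
    "('v, 'e) multigraph \<Rightarrow> ('v \<Rightarrow> real) \<Rightarrow> 'e \<Rightarrow> 'v set \<Rightarrow> real" where
  "contract_weight G \<upsilon> e X =
     (if X = set_uprod (ends G e) then (\<Sum>w \<in> set_uprod (ends G e). \<upsilon> w) else \<upsilon> (the_elem X))"

lemma weighted_multigraph_delete_edge:
  assumes "weighted_multigraph G \<upsilon> \<epsilon>"
  shows "weighted_multigraph (delete_edge G e) \<upsilon> \<epsilon>"
  using assms by (auto simp: weighted_multigraph_def delete_edge_def)

lemma weighted_multigraph_contract_edge:
  assumes "weighted_multigraph G \<upsilon> \<epsilon>" and "e \<in> edges G"
  shows "weighted_multigraph (contract_edge G e) (contract_weight G \<upsilon> e) \<epsilon>"
proof -
  interpret weighted_multigraph G \<upsilon> \<epsilon> by fact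
  have ne: "set_uprod (ends G e) \<noteq> {}"
    by (cases "ends G e") simp
  have ss: "set_uprod (ends G e) \<subseteq> verts G"
    using assms(2) by (rule ends_in_verts)
  have pos: "(\<Sum>w \<in> set_uprod (ends G e). \<upsilon> w) > 0"
    using ne ss vertex_weight_pos by (intro sum_pos) auto
  have im: "set_uprod (map_uprod f x) = f ` set_uprod x" for f :: "'a \<Rightarrow> 'a set" and x
    by (cases x) simp
  show ?thesis
  proof
    show "set_uprod (ends (contract_edge G e) a) \<subseteq> verts (contract_edge G e)"
      if "a \<in> edges (contract_edge G e)" for a
      using that ends_in_verts[of a] by (auto simp: contract_edge_def im)
    show "contract_weight G \<upsilon> e X > 0" if "X \<in> verts (contract_edge G e)" for X
      using that pos vertex_weight_pos
      by (auto simp: contract_edge_def contract_weight_def identify_ends_def)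
  qed (use finite_verts finite_edges edge_weight_pos in \<open>auto simp: contract_edge_def\<close>)
qed

end

theory Submission
  imports Defs
begin

text \<open>
  The Laplacian of a multigraph is the sum, over its edges \<open>xy\<close>, of \<open>\<epsilon>(xy) z z\<^sup>T\<close> with
  \<open>z = 1\<^sub>x - 1\<^sub>y\<close>; a loop has \<open>z = 0\<close> (\<open>laplacian_eq_sum_edges\<close>). Hence, with
  \<open>M = t W - L(G - e)\<close> and \<open>z\<close> the vector of the edge \<open>e = ab\<close>,
  the matrix \<open>t W - L(G)\<close> is the rank-one update \<open>M - \<epsilon>(e) z z\<^sup>T\<close>.

  Now add row \<open>a\<close> to row \<open>b\<close> and column \<open>a\<close> to column \<open>b\<close>. No determinant changes, and
  \<open>z\<close> becomes \<open>1\<^sub>a\<close>, so the update survives only in the entry \<open>(a, a)\<close>. Expanding along row \<open>a\<close>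
  leaves \<open>det M\<close> minus \<open>\<epsilon>(e)\<close> times the principal minor of the transformed \<open>M\<close> without \<open>a\<close>
  (\<open>det_on_subtract_edge\<close>). In that minor, row and column \<open>b\<close> are sums over \<open>{a, b}\<close>.

  This minor is the matrix of \<open>G/e\<close>. Indeed, a vertex of \<open>G/e\<close> is a set of
  vertices of \<open>G\<close>, and the \<open>(X, Y)\<close> entries of the Laplacian and of the vertex weight matrix of
  \<open>G/e\<close> are the sums over \<open>X \<times> Y\<close> of the entries for \<open>G - e\<close> (\<open>laplacian_contract_edge\<close>,
  \<open>diagonal_contract_weight\<close>). For the Laplacian this is seen edge by edge, since summing \<open>z z\<^sup>T\<close>
  over \<open>X \<times> Y\<close> gives the corresponding entry for the image of the edge in \<open>G/e\<close>. Edges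
  parallel to \<open>e\<close> become loops and contribute \<open>0\<close>.
\<close>

section \<open>Determinants indexed by a finite set\<close>

lemma det_on_cong:
  assumes "\<And>i j. i \<in> V \<Longrightarrow> j \<in> V \<Longrightarrow> M i j = N i j"
  shows "det_on V M = det_on V N"
  unfolding det_on_def using assms
  by (intro sum.cong arg_cong2[of _ _ _ _ times] prod.cong) (auto simp: permutes_in_image)

text \<open>Conjugation by \<open>f\<close> is a bijection between the permutations of \<open>V\<close> and of \<open>W\<close> that
  preserves signs. The two index sets may have different types, as the vertex sets of \<open>G\<close> and
  \<open>G/e\<close> do.\<close>

lemma det_on_reindex:
  assumes "finite V" and bij: "bij_betw f V W"
  shows "det_on W M = det_on V (\<lambda>i j. M (f i) (f j))"
proof -
  let ?g = "inv_into V f"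
  have inj: "inj_on f V" and W: "W = f ` V"
    using bij by (auto simp: bij_betw_def)
  have bij': "bij_betw ?g W V"
    using bij by (rule bij_betw_inv_into)
  have "det_on V (\<lambda>i j. M (f i) (f j)) =
      (\<Sum>p \<in> {p. p permutes W}. of_int (sign p) * (\<Prod>i \<in> W. M i (p i)))"
    unfolding det_on_def
  proof (rule sum.reindex_bij_witness[where j = "map_permutation V f" and i = "map_permutation W ?g"])
    fix p assume "p \<in> {p. p permutes V}"
    then have p: "p permutes V" by simp
    show "map_permutation W ?g (map_permutation V f p) = p"
      using inj by (intro map_permutation_compose_inv[OF bij p]) simp
    show "map_permutation V f p \<in> {p. p permutes W}"
      using map_permutation_permutes[OF bij p] by simp
    have "(\<Prod>i\<in>W. M i (map_permutation V f p i)) = (\<Prod>i\<in>V. M (f i) (f (p i)))"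
      unfolding W prod.reindex[OF inj] by (simp add: map_permutation_apply[OF inj])
    then show "of_int (sign (map_permutation V f p)) * (\<Prod>i\<in>W. M i (map_permutation V f p i)) =
        of_int (sign p) * (\<Prod>i\<in>V. M (f i) (f (p i)))"
      by (simp add: sign_map_permutation[OF inj p] \<open>finite V\<close>)
  next
    fix p assume "p \<in> {p. p permutes W}"
    then have p: "p permutes W" by simp
    show "map_permutation V f (map_permutation W ?g p) = p"
      by (rule map_permutation_compose_inv[OF bij' p]) (auto simp: W f_inv_into_f)
    show "map_permutation W ?g p \<in> {p. p permutes V}"
      using map_permutation_permutes[OF bij' p] by simp
  qed
  then show ?thesis by (simp add: det_on_def)
qed

lemma det_on_transpose:
  assumes "finite V"
  shows "det_on V (\<lambda>i j. M j i) = det_on V M"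
proof -
  have "of_int (sign (inv p)) * (\<Prod>i\<in>V. M (inv p i) i) = of_int (sign p) * (\<Prod>i\<in>V. M i (p i))"
    if p: "p permutes V" for p
  proof -
    have "(\<Prod>i\<in>V. M (inv p i) i) = (\<Prod>i\<in>V. M (inv p (p i)) (p i))"
      using prod.permute[OF p, of "\<lambda>i. M (inv p i) i"] by (simp add: o_def)
    moreover have "sign (inv p) = sign p"
      using p assms by (metis sign_inverse permutation_permutes)
    ultimately show ?thesis
      by (simp add: permutes_inverses[OF p])
  qed
  then show ?thesis
    unfolding det_on_def by (subst sum_permutations_inverse) (auto intro: sum.cong)
qed

lemma det_on_row_linear:
  assumes "finite V" and "b \<in> V"
  shows "det_on V (M(b := \<lambda>j. R j + S j)) = det_on V (M(b := R)) + det_on V (M(b := S))"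
proof -
  have "(\<Prod>i\<in>V. (M(b := T)) i (p i)) = T (p b) * (\<Prod>i\<in>V - {b}. M i (p i))" for T p
    using assms by (simp add: prod.remove[of V b])
  then show ?thesis
    by (simp add: det_on_def sum.distrib[symmetric] algebra_simps)
qed

text \<open>Composition with the transposition of \<open>a\<close> and \<open>b\<close> pairs each even permutation with an odd
  one having the same product of entries. This pairing works in every commutative ring, also
  where \<open>x = - x\<close> does not force \<open>x = 0\<close>.\<close>

lemma det_on_identical_rows:
  assumes "finite V" and ab: "a \<in> V" "b \<in> V" "a \<noteq> b" and eq: "M a = M b"
  shows "det_on V M = 0"
proof -
  let ?t = "Transposition.transpose a b"
  let ?F = "\<lambda>p. of_int (sign p) * (\<Prod>i\<in>V. M i (p i))"
  have t: "?t permutes V"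
    using ab by (simp add: permutes_swap_id)
  have perm: "permutation p" if "p permutes V" for p
    using that \<open>finite V\<close> by (auto simp: permutation_permutes)
  have sgn: "sign (p \<circ> ?t) = - sign p" if "p permutes V" for p
    using ab by (simp add: sign_compose[OF perm[OF that] perm[OF t]] sign_swap_id)
  have row: "M (?t i) = M i" for i
    using eq by (simp add: Transposition.transpose_def)
  have prod_t: "(\<Prod>i\<in>V. M i (p (?t i))) = (\<Prod>i\<in>V. M i (p i))" for p
    using prod.permute[OF t, of "\<lambda>i. M i (p i)"] by (simp add: o_def row)
  have fin: "finite {p. p permutes V}"
    using \<open>finite V\<close> by (rule finite_permutations)
  have "(\<Sum>p | p permutes V \<and> sign p = -1. ?F p) = (\<Sum>p | p permutes V \<and> sign p = 1. - ?F p)"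
    by (rule sum.reindex_bij_witness[where i = "\<lambda>p. p \<circ> ?t" and j = "\<lambda>p. p \<circ> ?t"])
      (auto simp: comp_assoc sgn permutes_compose[OF t] prod_t)
  moreover have "det_on V M =
      (\<Sum>p | p permutes V \<and> sign p = 1. ?F p) + (\<Sum>p | p permutes V \<and> sign p = -1. ?F p)"
    unfolding det_on_def
    by (subst sum.union_disjoint[symmetric])
      (use fin in \<open>auto intro!: sum.cong simp: sign_def split: if_splits\<close>)
  ultimately show ?thesis
    by (simp add: sum_negf)
qed

lemma det_on_add_row:
  assumes "finite V" and "a \<in> V" "b \<in> V" "a \<noteq> b"
  shows "det_on V (M(b := \<lambda>j. M b j + M a j)) = det_on V M"
proof -
  have "det_on V (M(b := M a)) = 0"
    by (rule det_on_identical_rows[OF assms]) (simp add: assms(4))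
  then show ?thesis
    by (simp only: det_on_row_linear[OF assms(1,3), of M "M b" "M a"] fun_upd_triv add_0_right)
qed

lemma det_on_add_column:
  assumes "finite V" and "a \<in> V" "b \<in> V" "a \<noteq> b"
  shows "det_on V (\<lambda>i. (M i)(b := M i b + M i a)) = det_on V M"
proof -
  let ?T = "\<lambda>i j. M j i"
  have "det_on V (\<lambda>i. (M i)(b := M i b + M i a)) =
      det_on V (\<lambda>i j. (?T(b := \<lambda>j. ?T b j + ?T a j)) j i)"
    by (intro det_on_cong) auto
  also have "\<dots> = det_on V (?T(b := \<lambda>j. ?T b j + ?T a j))"
    using assms(1) by (rule det_on_transpose)
  also have "\<dots> = det_on V ?T"
    using assms by (rule det_on_add_row)
  also have "\<dots> = det_on V M"
    using assms(1) by (rule det_on_transpose)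
  finally show ?thesis .
qed

text \<open>Only the permutations fixing \<open>a\<close> contribute, and these are the permutations of
  \<open>V - {a}\<close>, with the same sign.\<close>

lemma det_on_principal_minor:
  assumes "finite V" and "a \<in> V"
  shows "det_on V (M(a := \<lambda>j. if j = a then c else 0)) = c * det_on (V - {a}) M"
proof -
  let ?r = "\<lambda>j. if j = a then c else 0"
  have split: "(\<Prod>i\<in>V. (M(a := ?r)) i (p i)) = ?r (p a) * (\<Prod>i\<in>V - {a}. M i (p i))" for p
    using assms by (simp add: prod.remove[of V a])
  have sub: "{p. p permutes V - {a}} \<subseteq> {p. p permutes V}"
    by (auto intro: permutes_subset)
  have fix_a: "p permutes V - {a}" if "p permutes V" "p a = a" for p
    using that by (auto intro: permutes_superset)
  have "det_on V (M(a := ?r)) =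
      (\<Sum>p \<in> {p. p permutes V - {a}}. of_int (sign p) * (?r (p a) * (\<Prod>i\<in>V - {a}. M i (p i))))"
    unfolding det_on_def split
    by (rule sum.mono_neutral_right[OF finite_permutations[OF assms(1)] sub]) (use fix_a in auto)
  also have "\<dots> = c * det_on (V - {a}) M"
    unfolding det_on_def sum_distrib_left
    by (intro sum.cong) (auto simp: permutes_not_in algebra_simps)
  finally show ?thesis .
qed

section \<open>Subtracting the Laplacian of a single edge\<close>

text \<open>The vector \<open>z\<close> is \<open>1\<^sub>a - 1\<^sub>b\<close>. Adding the \<open>a\<close>-th row and column to the \<open>b\<close>-th ones turns
  \<open>z z\<^sup>T\<close> into the matrix unit at \<open>(a, a)\<close>, so the update affects a single diagonal entry and the
  determinant changes by \<open>c\<close> times a principal minor. The minor is written as sums over the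
  classes \<open>C i\<close>, where \<open>b\<close> stands for \<open>{a, b}\<close>, so that it can be read as a matrix on the contracted
  vertex set.\<close>

lemma det_on_subtract_edge:
  fixes M :: "'v \<Rightarrow> 'v \<Rightarrow> 'a::comm_ring_1"
  assumes "finite V" and ab: "a \<in> V" "b \<in> V" "a \<noteq> b"
  defines "z \<equiv> \<lambda>i. of_bool (a = i) - of_bool (b = i)"
    and "C \<equiv> \<lambda>i. if i = b then {a, b} else {i}"
  shows "det_on V (\<lambda>i j. M i j - c * (z i * z j)) =
    det_on V M - c * det_on (V - {a}) (\<lambda>i j. \<Sum>u \<in> C i. \<Sum>w \<in> C j. M u w)"
proof -
  define addrow :: "('v \<Rightarrow> 'v \<Rightarrow> 'a) \<Rightarrow> 'v \<Rightarrow> 'v \<Rightarrow> 'a" where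
    "addrow N = N(b := \<lambda>j. N b j + N a j)" for N
  define fold where "fold N = (\<lambda>i. (addrow N i)(b := addrow N i b + addrow N i a))" for N
  let ?M' = "\<lambda>i j. M i j - c * (z i * z j)"
  let ?m = "fold M"
  have det_fold: "det_on V (fold N) = det_on V N" for N
    unfolding fold_def det_on_add_column[OF assms(1-4)] unfolding addrow_def
    by (rule det_on_add_row[OF assms(1-4)])
  have "fold ?M' i j = (?m(a := \<lambda>j. ?m a j + (if j = a then - c else 0))) i j" for i j
    by (cases "i = a"; cases "i = b"; cases "j = a"; cases "j = b")
      (use ab in \<open>simp_all add: fold_def addrow_def z_def algebra_simps\<close>)
  then have "fold ?M' = ?m(a := \<lambda>j. ?m a j + (if j = a then - c else 0))"
    by blast
  then have "det_on V ?M' = det_on V (?m(a := \<lambda>j. ?m a j + (if j = a then - c else 0)))"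
    using det_fold[of ?M'] by simp
  also have "\<dots> = det_on V ?m + det_on V (?m(a := \<lambda>j. if j = a then - c else 0))"
    using det_on_row_linear[OF assms(1) ab(1), of ?m "?m a"] by simp
  also have "\<dots> = det_on V M - c * det_on (V - {a}) ?m"
    by (simp add: det_fold det_on_principal_minor[OF assms(1) ab(1)])
  also have "det_on (V - {a}) ?m = det_on (V - {a}) (\<lambda>i j. \<Sum>u \<in> C i. \<Sum>w \<in> C j. M u w)"
  proof (rule det_on_cong)
    fix i j
    show "?m i j = (\<Sum>u \<in> C i. \<Sum>w \<in> C j. M u w)"
      using ab by (cases "i = b"; cases "j = b") (simp_all add: fold_def addrow_def C_def algebra_simps)
  qed
  finally show ?thesis .
qed

section \<open>The Laplacian as a sum over edges\<close>

text \<open>The Laplacian of the graph with the single edge \<open>p\<close>, of weight \<open>1\<close>. Written without choosing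
  an orientation of \<open>p\<close>; the product form below is the matrix \<open>z z\<^sup>T\<close>, which is unchanged
  when \<open>z\<close> is replaced by \<open>- z\<close>.\<close>

definition edge_laplacian :: "'v uprod \<Rightarrow> 'v \<Rightarrow> 'v \<Rightarrow> real" where
  "edge_laplacian p u v =
     (if proper_uprod p \<and> u \<in> set_uprod p \<and> v \<in> set_uprod p then if u = v then 1 else - 1 else 0)"

lemma edge_laplacian_Upair:
  "edge_laplacian (Upair x y) u v =
     (of_bool (x = u) - of_bool (y = u)) * (of_bool (x = v) - of_bool (y = v))"
  by (auto simp: edge_laplacian_def)

text \<open>The double sum of \<open>z z\<^sup>T\<close> over \<open>X \<times> Y\<close> factors into the sums of \<open>z\<close> over \<open>X\<close> and over
  \<open>Y\<close>. If \<open>X\<close> and \<open>Y\<close> are classes of a partition, the value is an entry of the Laplacian of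
  the edge between the classes of \<open>x\<close> and \<open>y\<close>.\<close>

lemma sum_edge_laplacian:
  assumes "finite X" and "finite Y"
  shows "(\<Sum>u\<in>X. \<Sum>w\<in>Y. edge_laplacian (Upair x y) u w) =
    (of_bool (x \<in> X) - of_bool (y \<in> X)) * (of_bool (x \<in> Y) - of_bool (y \<in> Y))"
proof -
  have "(\<Sum>u\<in>Z. of_bool (x = u) - of_bool (y = u)) = (of_bool (x \<in> Z) - of_bool (y \<in> Z) :: real)"
    if "finite Z" for Z
    using that by (simp add: sum_subtractf of_bool_def)
  then show ?thesis
    using assms by (simp add: edge_laplacian_Upair sum_product[symmetric])
qed

text \<open>Both the adjacency entries and the degrees are linear in the edges. An edge \<open>xy\<close>
  contributes \<open>1\<^sub>x 1\<^sub>y\<^sup>T + 1\<^sub>y 1\<^sub>x\<^sup>T\<close> to the former and \<open>1\<^sub>x 1\<^sub>x\<^sup>T + 1\<^sub>y 1\<^sub>y\<^sup>T\<close> to the diagonal. For a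
  loop both equal \<open>2\<close> at its vertex and cancel, because loops count twice.\<close>

lemma (in weighted_multigraph) laplacian_eq_sum_edges:
  "laplacian G \<epsilon> u v = (\<Sum>a \<in> edges G. \<epsilon> a * edge_laplacian (ends G a) u v)"
proof -
  define mult where
    "mult a u v = (if ends G a = Upair u v then if u = v then 2 else 1 else (0 :: real))" for a u v
  have tw: "total_weight G \<epsilon> u v = (\<Sum>a \<in> edges G. \<epsilon> a * mult a u v)" for u v
    unfolding total_weight_def sum_distrib_left mult_def
    using finite_edges by (subst sum.inter_filter) (auto intro!: sum.cong)
  have deg: "weighted_degree G \<epsilon> u = (\<Sum>a \<in> edges G. \<epsilon> a * (\<Sum>v \<in> verts G. mult a u v))" for u
    unfolding weighted_degree_def tw sum_distrib_left by (rule sum.swap)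
  have "diagonal (\<lambda>u. \<Sum>v \<in> verts G. mult a u v) u v - mult a u v = edge_laplacian (ends G a) u v"
    if a: "a \<in> edges G" for a
  proof (cases "ends G a")
    case (Upair x y)
    have xy: "x \<in> verts G" "y \<in> verts G"
      using ends_in_verts[OF a] Upair by auto
    have m: "mult a u v = of_bool (x = u) * of_bool (y = v) + of_bool (y = u) * of_bool (x = v)" for u v
      by (auto simp: mult_def Upair)
    have "(\<Sum>v \<in> verts G. mult a u v) = of_bool (x = u) + of_bool (y = u)"
      using finite_verts xy by (simp add: m sum.distrib sum_distrib_left[symmetric] of_bool_def)
    then show ?thesis
      by (auto simp: Upair edge_laplacian_Upair m diagonal_def)
  qed
  then have "(\<Sum>a \<in> edges G. \<epsilon> a * edge_laplacian (ends G a) u v) =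
      (\<Sum>a \<in> edges G. \<epsilon> a * (diagonal (\<lambda>u. \<Sum>v \<in> verts G. mult a u v) u v - mult a u v))"
    by simp
  also have "\<dots> = laplacian G \<epsilon> u v"
    by (simp add: laplacian_def diagonal_def deg tw right_diff_distrib sum_subtractf)
  finally show ?thesis ..
qed

section \<open>Deletion and contraction\<close>

lemma (in weighted_multigraph) laplacian_delete_edge:
  assumes "e \<in> edges G"
  shows "laplacian G \<epsilon> u v =
    laplacian (delete_edge G e) \<epsilon> u v + \<epsilon> e * edge_laplacian (ends G e) u v"
proof -
  interpret D: weighted_multigraph "delete_edge G e" \<upsilon> \<epsilon>
    by (intro weighted_multigraph_delete_edge weighted_multigraph_axioms)
  show ?thesis
    unfolding laplacian_eq_sum_edges D.laplacian_eq_sum_edges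
    using finite_edges assms by (simp add: delete_edge_def sum.remove[of _ e])
qed

text \<open>The vertices of \<open>G/e\<close> are exactly the fibres of the map that identifies the ends of
  \<open>e\<close>.\<close>

lemma mem_contracted_vertex_iff:
  assumes "X \<in> verts (contract_edge G e)"
  shows "x \<in> X \<longleftrightarrow> identify_ends G e x = X"
  using assms by (auto simp: contract_edge_def identify_ends_def split: if_splits)

text \<open>Both sides are sums over the edges other than \<open>e\<close>, so it suffices to compare a single
  edge. An edge that becomes a loop at \<open>X\<close> contributes \<open>0\<close> on the left, and on the right the sum
  of its vector \<open>z\<close> over \<open>X\<close> vanishes.\<close>

lemma (in weighted_multigraph) laplacian_contract_edge:
  assumes "e \<in> edges G"
    and X: "X \<in> verts (contract_edge G e)" and Y: "Y \<in> verts (contract_edge G e)"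
  shows "laplacian (contract_edge G e) \<epsilon> X Y =
    (\<Sum>u\<in>X. \<Sum>w\<in>Y. laplacian (delete_edge G e) \<epsilon> u w)"
proof -
  interpret D: weighted_multigraph "delete_edge G e" \<upsilon> \<epsilon>
    by (intro weighted_multigraph_delete_edge weighted_multigraph_axioms)
  interpret C: weighted_multigraph "contract_edge G e" "contract_weight G \<upsilon> e" \<epsilon>
    by (intro weighted_multigraph_contract_edge weighted_multigraph_axioms assms(1))
  have fin: "finite Z" if "Z \<in> verts (contract_edge G e)" for Z
    using that by (auto simp: contract_edge_def identify_ends_def)
  have edge: "edge_laplacian (map_uprod (identify_ends G e) p) X Y =
      (\<Sum>u\<in>X. \<Sum>w\<in>Y. edge_laplacian p u w)" for p
  proof (cases p)
    case (Upair x y)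
    show ?thesis
      unfolding Upair map_uprod_simps sum_edge_laplacian[OF fin[OF X] fin[OF Y]]
        mem_contracted_vertex_iff[OF X] mem_contracted_vertex_iff[OF Y]
        edge_laplacian_Upair[of "identify_ends G e x"] ..
  qed
  have "laplacian (contract_edge G e) \<epsilon> X Y =
      (\<Sum>a \<in> edges G - {e}. \<Sum>u\<in>X. \<Sum>w\<in>Y. \<epsilon> a * edge_laplacian (ends G a) u w)"
    unfolding C.laplacian_eq_sum_edges by (simp add: contract_edge_def edge sum_distrib_left)
  also have "\<dots> = (\<Sum>u\<in>X. \<Sum>w\<in>Y. \<Sum>a \<in> edges G - {e}. \<epsilon> a * edge_laplacian (ends G a) u w)"
    by (subst sum.swap) (intro sum.cong refl sum.swap)
  also have "\<dots> = (\<Sum>u\<in>X. \<Sum>w\<in>Y. laplacian (delete_edge G e) \<epsilon> u w)"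
    unfolding D.laplacian_eq_sum_edges by (simp add: delete_edge_def)
  finally show ?thesis .
qed

lemma diagonal_contract_weight:
  assumes X: "X \<in> verts (contract_edge G e)" and Y: "Y \<in> verts (contract_edge G e)"
  shows "diagonal (contract_weight G \<upsilon> e) X Y = (\<Sum>u\<in>X. \<Sum>w\<in>Y. diagonal \<upsilon> u w)"
proof -
  have fin: "finite Y"
    using Y by (auto simp: contract_edge_def identify_ends_def)
  have "(\<Sum>u\<in>X. \<Sum>w\<in>Y. diagonal \<upsilon> u w) = (\<Sum>u\<in>X. if u \<in> Y then \<upsilon> u else 0)"
    using fin by (simp add: diagonal_def)
  also have "\<dots> = (if X = Y then \<Sum>u\<in>X. \<upsilon> u else 0)"
    by (auto simp: mem_contracted_vertex_iff[OF X] mem_contracted_vertex_iff[OF Y] intro!: sum.neutral)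
  also have "\<dots> = diagonal (contract_weight G \<upsilon> e) X Y"
    using X by (auto simp: diagonal_def contract_weight_def contract_edge_def identify_ends_def)
  finally show ?thesis ..
qed

theorem theorem4p4:
  fixes G :: "('v, 'e) multigraph"
    and \<upsilon> :: "'v \<Rightarrow> real"
    and \<epsilon> :: "'e \<Rightarrow> real"
    and e :: 'e
  assumes "weighted_multigraph G \<upsilon> \<epsilon>"
    and "e \<in> edges G"
    and "nonloop G e"
  shows "laplacian_poly G \<upsilon> \<epsilon> =
    laplacian_poly (delete_edge G e) \<upsilon> \<epsilon>
      - smult (\<epsilon> e) (laplacian_poly (contract_edge G e) (contract_weight G \<upsilon> e) \<epsilon>)"
proof -
  interpret weighted_multigraph G \<upsilon> \<epsilon> by fact
  obtain a b where ends: "ends G e = Upair a b"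
    by (cases "ends G e")
  have ab: "a \<in> verts G" "b \<in> verts G" "a \<noteq> b"
    using ends_in_verts[OF assms(2)] assms(3) ends by (auto simp: nonloop_def)
  let ?V = "verts G"
  let ?f = "identify_ends G e"
  let ?z = "\<lambda>i. of_bool (a = i) - of_bool (b = i) :: real poly"
  let ?C = "\<lambda>i. if i = b then {a, b} else {i}"
  define M where "M u v =
    [:0, 1:] * [:diagonal \<upsilon> u v:] - [:laplacian (delete_edge G e) \<epsilon> u v:]" for u v
  define N where "N X Y = [:0, 1:] * [:diagonal (contract_weight G \<upsilon> e) X Y:]
    - [:laplacian (contract_edge G e) \<epsilon> X Y:]" for X Y
  have f: "?f i = ?C i" if "i \<in> ?V - {a}" for i
    using that by (auto simp: identify_ends_def ends)
  have pG: "laplacian_poly G \<upsilon> \<epsilon> = det_on ?V (\<lambda>i j. M i j - [:\<epsilon> e:] * (?z i * ?z j))"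
    unfolding laplacian_poly_def
    by (intro det_on_cong)
      (auto simp: M_def laplacian_delete_edge[OF assms(2)] ends edge_laplacian_Upair)
  have pD: "laplacian_poly (delete_edge G e) \<upsilon> \<epsilon> = det_on ?V M"
  proof -
    have "verts (delete_edge G e) = ?V"
      by (simp add: delete_edge_def)
    then show ?thesis
      unfolding laplacian_poly_def by (simp add: M_def[abs_def])
  qed
  \<comment> \<open>Omitting \<open>a\<close> selects one representative of each vertex of \<open>G/e\<close>; the merged vertex is
    represented by \<open>b\<close>.\<close>
  have bij: "bij_betw ?f (?V - {a}) (verts (contract_edge G e))"
  proof -
    have "inj_on ?f (?V - {a})"
      by (auto simp: inj_on_def f split: if_splits)
    moreover have "?f ` ?V = ?f ` (?V - {a})"
    proof -
      have "?f a = ?f b"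
        by (simp add: identify_ends_def ends)
      then have "?f a \<in> ?f ` (?V - {a})"
        using ab by simp
      moreover have "?V = insert a (?V - {a})"
        using ab by blast
      ultimately show ?thesis
        by (metis image_insert insert_absorb)
    qed
    ultimately show ?thesis
      by (simp add: bij_betw_def contract_edge_def)
  qed
  have sum_M: "(\<Sum>u\<in>X. \<Sum>w\<in>Y. M u w) = N X Y"
    if XY: "X \<in> verts (contract_edge G e)" "Y \<in> verts (contract_edge G e)" for X Y
  proof -
    have const: "[:sum g A:] = (\<Sum>x\<in>A. [:g x:])" for g :: "'v \<Rightarrow> real" and A
    proof (induction A rule: infinite_finite_induct)
      case (insert x A)
      have "[:sum g (insert x A):] = [:g x:] + [:sum g A:]"
        using insert.hyps by simp
      also have "\<dots> = (\<Sum>x\<in>insert x A. [:g x:])"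
        unfolding insert.IH sum.insert[OF insert.hyps] ..
      finally show ?case .
    qed simp_all
    show ?thesis
      unfolding N_def laplacian_contract_edge[OF assms(2) XY] diagonal_contract_weight[OF XY]
      by (simp only: M_def const sum_subtractf sum_distrib_left)
  qed
  have "laplacian_poly (contract_edge G e) (contract_weight G \<upsilon> e) \<epsilon> =
      det_on (verts (contract_edge G e)) N"
    by (simp only: laplacian_poly_def N_def[abs_def])
  also have "\<dots> = det_on (?V - {a}) (\<lambda>i j. N (?f i) (?f j))"
    using finite_verts by (intro det_on_reindex[OF _ bij]) simp
  also have "\<dots> = det_on (?V - {a}) (\<lambda>i j. \<Sum>u \<in> ?C i. \<Sum>w \<in> ?C j. M u w)"
  proof (rule det_on_cong)
    fix i j assume ij: "i \<in> ?V - {a}" "j \<in> ?V - {a}"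
    have "(\<Sum>u \<in> ?f i. \<Sum>w \<in> ?f j. M u w) = N (?f i) (?f j)"
      by (rule sum_M; rule bij_betw_apply[OF bij]; fact ij)
    then show "N (?f i) (?f j) = (\<Sum>u \<in> ?C i. \<Sum>w \<in> ?C j. M u w)"
      by (simp only: f[OF ij(1)] f[OF ij(2)])
  qed
  finally show ?thesis
    unfolding pG pD det_on_subtract_edge[OF finite_verts ab] by simp
qed

end
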